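(* Let $\Omega_0,\Omega\subset\mathbb H^n$ be open, horizontally bounded sets such that $\Omega$ is $H$-convex and $\overline{\Omega_0}\subset\Omega$, and let $u,v:\Omega\to\mathbb R$ be $H$-convex functions. Let $\xi_0\in\Omega_0$ be such that $u(\xi_0)\le v(\xi_0)$ and $u\ge v$ on $\partial\Omega_0\cap H_{\xi_0}$. If $p_0\in\partial_Hv(\xi_0)$ satisfies $$v(\xi)>v(\xi_0)+p_0\cdot(\mathrm{Pr}_1(\xi)-\mathrm{Pr}_1(\xi_0))\qquad\forall\xi\in\partial\Omega_0\cap H_{\xi_0},$$ then $p_0\in\partial_Hu(\Omega_0\cap H_{\xi_0})$.
   Context: $\mathbb H^n=\mathbb C^n\times\mathbb R\cong\mathbb R^{2n+1}$ with real coordinates $(x,y,t)$, $z=x+iy$, group law $(z,t)\circ(z',t')=(z+z',t+t'+2\,\mathrm{Im}\langle z,z'\rangle)$, $\langle z,z'\rangle=\sum_j z_j\overline{z'_j}$. Dilations $\delta_\lambda(z,t)=(\lambda z,\lambda^2t)$. Horizontal plane at $\xi_0=(x_0,y_0,t_0)$: $H_{\xi_0}=\{(x,y,t):t=t_0+2(x\cdot y_0-x_0\cdot y)\}$. $\mathrm{Pr}_1(x,y,t)=(x,y)$. Gauge $N(z,t)=(|z|^4+t^2)^{1/4}$, $d_H(\xi,\zeta)=N(\zeta^{-1}\circ\xi)$, $\mathrm{diam}_H$ the $d_H$-diameter. A set $\tilde\Omega$ is $H$-convex if for all $\xi_1,\xi_2\in\tilde\Omega$ with $\xi_1\in H_{\xi_2}$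 and $\lambda\in[0,1]$, $\xi_1\circ\delta_\lambda(\xi_1^{-1}\circ\xi_2)\in\tilde\Omega$; a function $u$ on $\tilde\Omega$ is $H$-convex if $u(\xi_1\circ\delta_\lambda(\xi_1^{-1}\circ\xi_2))\le(1-\lambda)u(\xi_1)+\lambda u(\xi_2)$ for all such $\xi_1,\xi_2,\lambda$. An open set is horizontally bounded if $\sup\{\mathrm{diam}_H(\Omega\cap H_\xi):\xi\in\Omega\}<\infty$. For $w:\Omega\to\mathbb R$ and $\xi\in\Omega$, $\partial_Hw(\xi)=\{p\in\mathbb R^{2n}:w(\zeta)\ge w(\xi)+p\cdot(\mathrm{Pr}_1(\zeta)-\mathrm{Pr}_1(\xi))\ \forall\zeta\in\Omega\cap H_{\xi}\}$ and $\partial_Hw(E)=\bigcup_{\xi\in E}\partial_Hw(\xi)$. *)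

theory Defs
  imports "HOL-Analysis.Analysis"
begin

text \<open>Points of the Heisenberg group H^n = C^n x R, written in real coordinates (x,y,t),
  with z = x + i y, x,y in R^n (index type 'n, n = CARD('n)).\<close>
type_synonym 'n heis = "(real^'n) \<times> (real^'n) \<times> real"

text \<open>Im<z,z'> = sum_j (y_j x'_j - x_j y'_j) for z = x+iy, z' = x'+iy'.\<close>
definition heis_mult :: "'n::finite heis \<Rightarrow> 'n heis \<Rightarrow> 'n heis" (infixl "\<circ>\<^sub>H" 70) where
  "heis_mult a b = (case a of (x,y,t) \<Rightarrow> case b of (x',y',t') \<Rightarrow>
     (x + x', y + y', t + t' + 2 * (y \<bullet> x' - x \<bullet> y')))"

definition heis_inv :: "'n::finite heis \<Rightarrow> 'n heis" where
  "heis_inv a = (case a of (x,y,t) \<Rightarrow> (-x, -y, -t))"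

definition heis_dil :: "real \<Rightarrow> 'n::finite heis \<Rightarrow> 'n heis" where
  "heis_dil r a = (case a of (x,y,t) \<Rightarrow> (r *\<^sub>R x, r *\<^sub>R y, r\<^sup>2 * t))"

definition hplane :: "'n::finite heis \<Rightarrow> 'n heis set" where
  "hplane \<xi>0 = (case \<xi>0 of (x0,y0,t0) \<Rightarrow>
     {(x,y,t). t = t0 + 2 * (x \<bullet> y0 - x0 \<bullet> y)})"

definition Pr1 :: "'n::finite heis \<Rightarrow> (real^'n) \<times> (real^'n)" where
  "Pr1 a = (case a of (x,y,t) \<Rightarrow> (x,y))"

definition gauge :: "'n::finite heis \<Rightarrow> real" where
  "gauge a = (case a of (x,y,t) \<Rightarrow> ((norm x ^ 2 + norm y ^ 2) ^ 2 + t ^ 2) powr (1/4))"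

definition dH :: "'n::finite heis \<Rightarrow> 'n heis \<Rightarrow> real" where
  "dH \<xi> \<zeta> = gauge (heis_inv \<zeta> \<circ>\<^sub>H \<xi>)"

definition horiz_bounded :: "'n::finite heis set \<Rightarrow> bool" where
  "horiz_bounded \<Omega> \<longleftrightarrow> (\<exists>C. \<forall>\<xi>\<in>\<Omega>. \<forall>a\<in>\<Omega> \<inter> hplane \<xi>. \<forall>b\<in>\<Omega> \<inter> hplane \<xi>. dH a b \<le> C)"

definition Hconvex_set :: "'n::finite heis set \<Rightarrow> bool" where
  "Hconvex_set \<Omega> \<longleftrightarrow> (\<forall>\<xi>1\<in>\<Omega>. \<forall>\<xi>2\<in>\<Omega>. \<forall>r::real. \<xi>1 \<in> hplane \<xi>2 \<and> 0 \<le> r \<and> r \<le> 1 \<longrightarrow>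
      \<xi>1 \<circ>\<^sub>H heis_dil r (heis_inv \<xi>1 \<circ>\<^sub>H \<xi>2) \<in> \<Omega>)"

definition Hconvex_fun :: "'n::finite heis set \<Rightarrow> ('n heis \<Rightarrow> real) \<Rightarrow> bool" where
  "Hconvex_fun \<Omega> u \<longleftrightarrow> (\<forall>\<xi>1\<in>\<Omega>. \<forall>\<xi>2\<in>\<Omega>. \<forall>r::real. \<xi>1 \<in> hplane \<xi>2 \<and> 0 \<le> r \<and> r \<le> 1 \<longrightarrow>
      u (\<xi>1 \<circ>\<^sub>H heis_dil r (heis_inv \<xi>1 \<circ>\<^sub>H \<xi>2)) \<le> (1 - r) * u \<xi>1 + r * u \<xi>2)"

definition Hsubdiff :: "'n::finite heis set \<Rightarrow> ('n heis \<Rightarrow> real) \<Rightarrow> 'n heis \<Rightarrow> ((real^'n) \<times> (real^'n)) set" where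
  "Hsubdiff \<Omega> w \<xi> = {p. \<forall>\<zeta>\<in>\<Omega> \<inter> hplane \<xi>. w \<zeta> \<ge> w \<xi> + p \<bullet> (Pr1 \<zeta> - Pr1 \<xi>)}"

definition Hsubdiff_set :: "'n::finite heis set \<Rightarrow> ('n heis \<Rightarrow> real) \<Rightarrow> 'n heis set \<Rightarrow> ((real^'n) \<times> (real^'n)) set" where
  "Hsubdiff_set \<Omega> w E = (\<Union>\<xi>\<in>E. Hsubdiff \<Omega> w \<xi>)"

end

theory Submission
  imports Defs
begin

text \<open>After subtracting a linear function one may take \<open>p0 = 0\<close>; the hypotheses then only say that
  \<open>u\<close> exceeds \<open>u \<xi>0\<close> on the boundary of the bounded slice of \<open>\<Omega>0\<close> by the horizontal plane at
  \<open>\<xi>0\<close>, and one looks for a point of the slice at which \<open>u\<close> is minimal on the horizontal plane of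
  that point.

  H-convex functions are continuous: horizontal segments with endpoints in a finite set already
  control \<open>u\<close> from above near a point. Walking along \<open>h\<^sub>1, \<dots>, h\<^sub>m, h\<^sub>m, \<dots>, h\<^sub>1\<close> in horizontal steps
  with \<open>h\<^sub>1 + \<dots> + h\<^sub>m = 0\<close> leads back to the starting point, since the vertical displacements of
  the two halves cancel. By continuity descent directions at a point remain so nearby, hence they
  never have zero as a positive combination. If no point of the slice were a minimum as above, descent
  directions could be glued to a vector field without zeros pointing inwards on a large sphere,
  which contradicts Brouwer's theorem.\<close>

section \<open>Horizontal steps and horizontal planes\<close>

text \<open>\<open>hstep \<xi>\<close> is the chart of \<open>hplane \<xi>\<close> by R^2n that
  sends 0 to \<open>\<xi>\<close>; it turns slices by the plane into subsets of a vector
  space.\<close>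

definition hstep :: "'n::finite heis \<Rightarrow> (real^'n) \<times> (real^'n) \<Rightarrow> 'n heis" where
  "hstep \<xi> h = \<xi> \<circ>\<^sub>H (fst h, snd h, 0)"

text \<open>This is Im<w,z>, the symplectic form whose double is the vertical term of the group
  law.\<close>

definition symp :: "(real^'n) \<times> (real^'n) \<Rightarrow> (real^'n::finite) \<times> (real^'n) \<Rightarrow> real" where
  "symp w z = snd w \<bullet> fst z - fst w \<bullet> snd z"

lemmas heis_unfold = hstep_def heis_mult_def heis_inv_def heis_dil_def hplane_def Pr1_def
  symp_def split_beta

lemma abs_symp_le: "\<bar>symp w z\<bar> \<le> 2 * (norm w * norm z)"
proof -
  have "\<bar>symp w z\<bar> \<le> \<bar>snd w \<bullet> fst z\<bar> + \<bar>fst w \<bullet> snd z\<bar>"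
    unfolding symp_def by linarith
  also have "\<dots> \<le> norm (snd w) * norm (fst z) + norm (fst w) * norm (snd z)"
    by (intro add_mono Cauchy_Schwarz_ineq2)
  also have "\<dots> \<le> norm w * norm z + norm w * norm z"
    by (intro add_mono mult_mono norm_ge_zero) (metis norm_fst_le norm_snd_le surjective_pairing)+
  finally show ?thesis by simp
qed

lemma hstep_zero [simp]: "hstep \<xi> 0 = \<xi>"
  by (simp add: heis_unfold)

text \<open>Since \<open>symp h h = 0\<close>, multiples of one direction compose without a vertical
  correction.\<close>

lemma hstep_hstep: "hstep (hstep \<xi> (a *\<^sub>R h)) (b *\<^sub>R h) = hstep \<xi> ((a + b) *\<^sub>R h)"
  by (simp add: heis_unfold algebra_simps inner_commute)

lemma hstep_hstep_minus [simp]: "hstep (hstep \<xi> h) (- h) = \<xi>"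
  using hstep_hstep[of \<xi> 1 h "-1"] by simp

lemma Pr1_hstep [simp]: "Pr1 (hstep \<xi> h) = Pr1 \<xi> + h"
  by (simp add: heis_unfold prod_eq_iff)

lemma hstep_mem_hplane: "hstep \<xi> h \<in> hplane \<xi>"
  by (auto simp: heis_unfold algebra_simps inner_commute)

lemma mem_hplane_hstep: "\<xi> \<in> hplane (hstep \<xi> h)"
  by (auto simp: heis_unfold algebra_simps inner_commute)

lemma hplane_eq_hstep: "\<zeta> \<in> hplane \<xi> \<Longrightarrow> \<zeta> = hstep \<xi> (Pr1 \<zeta> - Pr1 \<xi>)"
  by (cases \<zeta>, cases \<xi>) (auto simp: heis_unfold algebra_simps inner_commute)

text \<open>A horizontal vector has height 0, so \<open>heis_dil\<close> acts on it as a scalar. The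
  segments in the definition of H-convexity are therefore straight in the chart
  \<open>hstep \<xi>\<close>.\<close>

lemma heis_segment:
  "\<xi> \<circ>\<^sub>H heis_dil r (heis_inv \<xi> \<circ>\<^sub>H hstep \<xi> h) = hstep \<xi> (r *\<^sub>R h)"
  by (simp add: heis_unfold algebra_simps inner_commute)

lemma tendsto_hstep [tendsto_intros]:
  assumes "(p \<longlongrightarrow> \<xi>) F" "(h \<longlongrightarrow> k) F"
  shows "((\<lambda>x. hstep (p x) (h x)) \<longlongrightarrow> hstep \<xi> k) F"
  unfolding heis_unfold fst_conv snd_conv by (intro tendsto_intros assms)

lemma continuous_on_hstep [continuous_intros]:
  assumes "continuous_on S p" "continuous_on S h"
  shows "continuous_on S (\<lambda>x. hstep (p x) (h x))"
  using assms unfolding continuous_on_def by (auto intro: tendsto_hstep)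

text \<open>The gauge of a horizontal vector is its Euclidean norm; this turns horizontal
  boundedness into boundedness in the chart.\<close>

lemma dH_hstep: "dH (hstep \<xi> h) \<xi> = norm h"
proof -
  have "heis_inv \<xi> \<circ>\<^sub>H hstep \<xi> h = (fst h, snd h, 0)"
    by (simp add: heis_unfold algebra_simps inner_commute)
  moreover have "norm (fst h) ^ 2 + norm (snd h) ^ 2 = norm h ^ 2"
    by (cases h) (simp add: norm_Pair)
  moreover have "(norm h ^ 4) powr (1/4) = norm h"
  proof (cases "h = 0")
    case False
    then have "norm h ^ 4 = norm h powr 4" by simp
    then show ?thesis by (simp only: powr_powr) simp
  qed simp
  moreover have "((norm h)\<^sup>2)\<^sup>2 = norm h ^ 4" by simp
  ultimately show ?thesis
    by (simp add: dH_def gauge_def)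
qed

text \<open>Induction peels off the outermost pair of equal steps \<open>a\<close>. With
  \<open>s\<close> the step in between, the vertical terms from \<open>symp a s\<close> and
  \<open>symp s a\<close> cancel by antisymmetry.\<close>

lemma foldl_hstep_palindrome:
  "foldl hstep \<xi> (hs @ rev hs) = hstep \<xi> (2 *\<^sub>R sum_list hs)"
proof (induction hs arbitrary: \<xi>)
  case (Cons a hs)
  have "foldl hstep \<xi> ((a # hs) @ rev (a # hs)) = hstep (foldl hstep (hstep \<xi> a) (hs @ rev hs)) a"
    by simp
  also have "\<dots> = hstep (hstep (hstep \<xi> a) (2 *\<^sub>R sum_list hs)) a"
    using Cons.IH by simp
  also have "\<dots> = hstep \<xi> (2 *\<^sub>R sum_list (a # hs))"
    by (simp add: heis_unfold algebra_simps inner_commute) (simp add: vec_eq_iff)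
  finally show ?case .
qed simp

section \<open>H-convexity along horizontal lines and local upper bounds\<close>

locale hconvex =
  fixes \<Omega> :: "'n::finite heis set" and u :: "'n heis \<Rightarrow> real"
  assumes op: "open \<Omega>" and set: "Hconvex_set \<Omega>" and func: "Hconvex_fun \<Omega> u"
begin

lemma hstep_mem:
  assumes "\<xi> \<in> \<Omega>" "hstep \<xi> h \<in> \<Omega>" "0 \<le> r" "r \<le> 1"
  shows "hstep \<xi> (r *\<^sub>R h) \<in> \<Omega>"
  using set assms mem_hplane_hstep[of \<xi> h] heis_segment[of \<xi> r h] unfolding Hconvex_set_def by metis

lemma hstep_le:
  assumes "\<xi> \<in> \<Omega>" "hstep \<xi> h \<in> \<Omega>" "0 \<le> r" "r \<le> 1"
  shows "u (hstep \<xi> (r *\<^sub>R h)) \<le> (1 - r) * u \<xi> + r * u (hstep \<xi> h)"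
  using func assms mem_hplane_hstep[of \<xi> h] heis_segment[of \<xi> r h] unfolding Hconvex_fun_def by metis

text \<open>\<open>\<xi>\<close> is the convex combination of the two end points with weight
  \<open>a / (a + b)\<close> on the second. Membership in \<open>\<Omega>\<close> is a conclusion,
  so that bounds and neighbourhoods spread together.\<close>

lemma between:
  assumes "hstep \<xi> (- (a *\<^sub>R h)) \<in> \<Omega>" "hstep \<xi> (b *\<^sub>R h) \<in> \<Omega>" "0 \<le> a" "0 \<le> b" "0 < a + b"
    and "u (hstep \<xi> (- (a *\<^sub>R h))) \<le> M" "u (hstep \<xi> (b *\<^sub>R h)) \<le> M"
  shows "\<xi> \<in> \<Omega>" "u \<xi> \<le> M"
proof -
  let ?q = "hstep \<xi> ((- a) *\<^sub>R h)" and ?r = "a / (a + b)"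
  have e: "hstep ?q ((a + b) *\<^sub>R h) = hstep \<xi> (b *\<^sub>R h)"
    by (subst hstep_hstep) simp
  have m: "hstep ?q (?r *\<^sub>R ((a + b) *\<^sub>R h)) = \<xi>"
    using assms(5) by (simp add: hstep_hstep del: scaleR_minus_left)
  have r: "0 \<le> ?r" "?r \<le> 1" using assms by auto
  show "\<xi> \<in> \<Omega>"
    using hstep_mem[of ?q "(a + b) *\<^sub>R h" ?r] assms e m r by simp
  have "u \<xi> \<le> (1 - ?r) * u ?q + ?r * u (hstep \<xi> (b *\<^sub>R h))"
    using hstep_le[of ?q "(a + b) *\<^sub>R h" ?r] assms e m r by simp
  also have "\<dots> \<le> (1 - ?r) * M + ?r * M"
    using assms r by (intro add_mono mult_left_mono) auto
  finally show "u \<xi> \<le> M" by (simp add: algebra_simps)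
qed

text \<open>The point over \<open>\<xi>\<close> at height \<open>t\<close> is the midpoint of two points lying on two fixed horizontal
  segments, so that finitely many values of \<open>u\<close> control a vertical segment.\<close>

lemma bounded_above_vertical:
  assumes "\<xi> \<in> \<Omega>"
  obtains e M where "0 < e"
    "\<And>t. \<bar>t\<bar> < e \<Longrightarrow> \<xi> \<circ>\<^sub>H (0, 0, t) \<in> \<Omega> \<and> u (\<xi> \<circ>\<^sub>H (0, 0, t)) \<le> M"
proof -
  obtain i :: 'n where True by simp
  define e :: "real^'n" where "e = axis i 1"
  have ee: "e \<bullet> e = 1" by (simp add: e_def inner_axis_axis)
  \<comment> \<open>For signs \<open>a\<close> and \<open>b\<close> these are the end points of two
    segments in direction \<open>(e, 0)\<close>, displaced from \<open>\<xi>\<close> to either side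
    in the conjugate direction \<open>(0, e)\<close>.\<close>
  define q where "q \<delta> a b = hstep (hstep \<xi> (0, (a * \<delta>) *\<^sub>R e)) ((b * \<delta>) *\<^sub>R (e, 0))" for \<delta> a b
  have ev: "\<forall>\<^sub>F \<delta> in at_right 0. q \<delta> a b \<in> \<Omega>" for a b
  proof -
    have "((\<lambda>\<delta>. q \<delta> a b) \<longlongrightarrow> hstep (hstep \<xi> (0, (a * 0) *\<^sub>R e)) ((b * 0) *\<^sub>R (e, 0))) (at_right 0)"
      unfolding q_def by (intro tendsto_intros)
    then have "((\<lambda>\<delta>. q \<delta> a b) \<longlongrightarrow> \<xi>) (at_right 0)"
      by (simp flip: zero_prod_def)
    then show ?thesis using op assms topological_tendstoD by blast
  qed
  have "\<forall>\<^sub>F \<delta>::real in at_right 0. 0 < \<delta> \<and> q \<delta> 1 1 \<in> \<Omega> \<and> q \<delta> 1 (-1) \<in> \<Omega> \<and> q \<delta> (-1) 1 \<in> \<Omega> \<and> q \<delta> (-1) (-1) \<in> \<Omega>"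
    by (intro eventually_conj ev eventually_at_right_less)
  then obtain \<delta> :: real where \<delta>: "0 < \<delta>" "q \<delta> 1 1 \<in> \<Omega>" "q \<delta> 1 (-1) \<in> \<Omega>" "q \<delta> (-1) 1 \<in> \<Omega>" "q \<delta> (-1) (-1) \<in> \<Omega>"
    using eventually_happens'[OF trivial_limit_at_right_real] by blast
  define M where "M = Max {u (q \<delta> 1 1), u (q \<delta> 1 (-1)), u (q \<delta> (-1) 1), u (q \<delta> (-1) (-1))}"
  have side: "hstep (hstep \<xi> (0, (c * \<delta>) *\<^sub>R e)) (a *\<^sub>R (e, 0)) \<in> \<Omega> \<and>
      u (hstep (hstep \<xi> (0, (c * \<delta>) *\<^sub>R e)) (a *\<^sub>R (e, 0))) \<le> M"
    if "\<bar>a\<bar> \<le> \<delta>" "c = 1 \<or> c = -1" for a c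
  proof -
    let ?p = "hstep (hstep \<xi> (0, (c * \<delta>) *\<^sub>R e)) (a *\<^sub>R (e, 0))"
    have 1: "hstep ?p (- ((\<delta> + a) *\<^sub>R (e, 0))) = q \<delta> c (-1)"
      unfolding q_def scaleR_minus_left[symmetric] hstep_hstep by simp
    have 2: "hstep ?p ((\<delta> - a) *\<^sub>R (e, 0)) = q \<delta> c 1"
      unfolding q_def hstep_hstep by simp
    have "q \<delta> c (-1) \<in> \<Omega>" "q \<delta> c 1 \<in> \<Omega>" "u (q \<delta> c (-1)) \<le> M" "u (q \<delta> c 1) \<le> M"
      using that(2) \<delta> by (auto simp: M_def)
    then show ?thesis
      using between[of ?p "\<delta> + a" "(e, 0)" "\<delta> - a" M] that(1) \<delta>(1) unfolding 1 2 by auto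
  qed
  show ?thesis
  proof (rule that[of "2 * \<delta>\<^sup>2" M])
    show "0 < 2 * \<delta>\<^sup>2" using \<delta> by simp
    fix t assume t: "\<bar>t\<bar> < 2 * \<delta>\<^sup>2"
    \<comment> \<open>The points at offset \<open>a\<close> on one segment and \<open>- a\<close> on
      the other both gain height \<open>2 * \<delta> * a\<close>, the two sign changes cancelling.
      Equating this with \<open>t\<close> makes \<open>?p\<close> their midpoint.\<close>
    define a where "a = t / (2 * \<delta>)"
    have a: "\<bar>a\<bar> \<le> \<delta>" "\<bar>- a\<bar> \<le> \<delta>" and t_eq: "t = 2 * \<delta> * a"
      using t \<delta>(1) by (auto simp: a_def abs_mult divide_simps power2_eq_square)
    let ?p = "\<xi> \<circ>\<^sub>H (0, 0, t)"
    have 1: "hstep ?p (1 *\<^sub>R (a *\<^sub>R e, \<delta> *\<^sub>R e)) = hstep (hstep \<xi> (0, (1 * \<delta>) *\<^sub>R e)) (a *\<^sub>R (e, 0))"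
      by (simp add: heis_unfold t_eq algebra_simps ee)
    have 2: "hstep ?p (- (1 *\<^sub>R (a *\<^sub>R e, \<delta> *\<^sub>R e))) = hstep (hstep \<xi> (0, ((-1) * \<delta>) *\<^sub>R e)) ((-a) *\<^sub>R (e, 0))"
      by (simp add: heis_unfold t_eq algebra_simps ee)
    show "?p \<in> \<Omega> \<and> u ?p \<le> M"
      using between[of ?p 1 "(a *\<^sub>R e, \<delta> *\<^sub>R e)" 1 M] side[OF a(1), of 1] side[OF a(2), of "-1"]
      unfolding 1 2 by auto
  qed
qed

text \<open>Induction on the directions in which a point may move away from the vertical line. For a
  new direction \<open>b\<close>, a point near \<open>\<xi>\<close> lies on a segment in direction
  \<open>b\<close> whose ends are near \<open>hstep \<xi> (\<delta> *\<^sub>R b)\<close> and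
  \<open>hstep \<xi> (- \<delta> *\<^sub>R b)\<close>, where the induction hypothesis gives
  bounds.\<close>

lemma bounded_above_along:
  fixes B :: "((real^'n) \<times> (real^'n)) set"
  assumes "finite B" "B \<subseteq> Basis" "\<xi> \<in> \<Omega>"
  shows "\<exists>e M. 0 < e \<and> (\<forall>w t. (\<forall>b\<in>Basis - B. w \<bullet> b = 0) \<longrightarrow> norm w < e \<longrightarrow> \<bar>t\<bar> < e \<longrightarrow>
    \<xi> \<circ>\<^sub>H (fst w, snd w, t) \<in> \<Omega> \<and> u (\<xi> \<circ>\<^sub>H (fst w, snd w, t)) \<le> M)"
  using assms
proof (induction B arbitrary: \<xi> rule: finite_induct)
  case empty
  obtain e M where eM: "0 < e"
    "\<And>t. \<bar>t\<bar> < e \<Longrightarrow> \<xi> \<circ>\<^sub>H (0, 0, t) \<in> \<Omega> \<and> u (\<xi> \<circ>\<^sub>H (0, 0, t)) \<le> M"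
    using bounded_above_vertical[OF empty(2)] by blast
  have "w = 0" if "\<forall>b\<in>Basis - {}. w \<bullet> b = 0" for w :: "(real^'n) \<times> (real^'n)"
    using that euclidean_all_zero_iff by auto
  then show ?case using eM by (metis fst_zero snd_zero)
next
  case (insert b B)
  then have b: "b \<in> Basis" "norm b = 1" by auto
  have ev: "\<forall>\<^sub>F \<delta> in at_right 0. hstep \<xi> ((c * \<delta>) *\<^sub>R b) \<in> \<Omega>" for c
  proof -
    have "((\<lambda>\<delta>. hstep \<xi> ((c * \<delta>) *\<^sub>R b)) \<longlongrightarrow> hstep \<xi> ((c * 0) *\<^sub>R b)) (at_right 0)"
      by (intro tendsto_intros)
    then have "((\<lambda>\<delta>. hstep \<xi> ((c * \<delta>) *\<^sub>R b)) \<longlongrightarrow> \<xi>) (at_right 0)" by simp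
    then show ?thesis using op insert.prems topological_tendstoD by blast
  qed
  have "\<forall>\<^sub>F \<delta>::real in at_right 0. 0 < \<delta> \<and> \<delta> < 1 \<and> hstep \<xi> ((1 * \<delta>) *\<^sub>R b) \<in> \<Omega> \<and> hstep \<xi> ((-1 * \<delta>) *\<^sub>R b) \<in> \<Omega>"
    by (intro eventually_conj ev eventually_at_right_less) (auto intro: eventually_at_rightI[of 0 1])
  then obtain \<delta> :: real where \<delta>: "0 < \<delta>" "\<delta> < 1" "hstep \<xi> ((1 * \<delta>) *\<^sub>R b) \<in> \<Omega>" "hstep \<xi> ((-1 * \<delta>) *\<^sub>R b) \<in> \<Omega>"
    using eventually_happens'[OF trivial_limit_at_right_real] by blast
  obtain e1 M1 where 1: "0 < e1" "\<And>w t. \<forall>b\<in>Basis - B. w \<bullet> b = 0 \<Longrightarrow> norm w < e1 \<Longrightarrow> \<bar>t\<bar> < e1 \<Longrightarrow>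
      hstep \<xi> ((1 * \<delta>) *\<^sub>R b) \<circ>\<^sub>H (fst w, snd w, t) \<in> \<Omega> \<and> u (hstep \<xi> ((1 * \<delta>) *\<^sub>R b) \<circ>\<^sub>H (fst w, snd w, t)) \<le> M1"
    using insert.IH[OF _ \<delta>(3)] insert.prems by blast
  obtain e2 M2 where 2: "0 < e2" "\<And>w t. \<forall>b\<in>Basis - B. w \<bullet> b = 0 \<Longrightarrow> norm w < e2 \<Longrightarrow> \<bar>t\<bar> < e2 \<Longrightarrow>
      hstep \<xi> ((-1 * \<delta>) *\<^sub>R b) \<circ>\<^sub>H (fst w, snd w, t) \<in> \<Omega> \<and> u (hstep \<xi> ((-1 * \<delta>) *\<^sub>R b) \<circ>\<^sub>H (fst w, snd w, t)) \<le> M2"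
    using insert.IH[OF _ \<delta>(4)] insert.prems by blast
  \<comment> \<open>The ends of the segment have height at most
    \<open>\<bar>t\<bar> + 24 * norm w\<close>, which is below \<open>25 * e\<close>; the factor 30
    leaves room.\<close>
  define e where "e = min \<delta> (min e1 e2 / 30)"
  show ?case
  proof (rule exI[of _ e], rule exI[of _ "max M1 M2"], intro conjI allI impI)
    show "0 < e" using \<delta> 1 2 by (simp add: e_def)
    fix w :: "(real^'n) \<times> (real^'n)" and t :: real
    assume w: "\<forall>b\<in>Basis - insert b B. w \<bullet> b = 0" "norm w < e" and t: "\<bar>t\<bar> < e"
    define s where "s = w \<bullet> b"
    define w' where "w' = w - s *\<^sub>R b"
    have s: "\<bar>s\<bar> \<le> norm w" using Basis_le_norm[OF b(1)] by (simp add: s_def)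
    then have sd: "\<bar>s\<bar> < \<delta>" using w(2) by (simp add: e_def)
    have nw': "norm w' \<le> 2 * norm w"
      using norm_triangle_ineq4[of w "s *\<^sub>R b"] s b(2) by (simp add: w'_def)
    have perp: "\<forall>b\<in>Basis - B. w' \<bullet> b = 0"
      using w(1) b(1) by (auto simp: w'_def s_def inner_diff_left inner_Basis)
    have sy: "\<bar>symp w' b\<bar> \<le> 4 * norm w"
      using abs_symp_le[of w' b] nw' b(2) by simp
    have T: "\<bar>t + 2 * ((2 * c * \<delta> - s) * symp w' b)\<bar> < 30 * e" if "c = 1 \<or> c = -1" for c
    proof -
      have "\<bar>(2 * c * \<delta> - s) * symp w' b\<bar> \<le> 3 * (4 * norm w)"
        unfolding abs_mult using sy sd \<delta> that by (intro mult_mono) auto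
      then show ?thesis using w(2) t by linarith
    qed
    have e30: "30 * e \<le> e1" "30 * e \<le> e2" by (auto simp: e_def)
    then have nw: "norm w' < e1" "norm w' < e2" using nw' w(2) norm_ge_zero[of w] by linarith+
    let ?p = "\<xi> \<circ>\<^sub>H (fst w, snd w, t)"
    have E: "hstep ?p ((c * \<delta> - s) *\<^sub>R b) =
        hstep \<xi> ((c * \<delta>) *\<^sub>R b) \<circ>\<^sub>H (fst w', snd w', t + 2 * ((2 * c * \<delta> - s) * symp w' b))" for c
      by (simp add: heis_unfold w'_def algebra_simps inner_commute)
    have P: "hstep ?p ((\<delta> - s) *\<^sub>R b) \<in> \<Omega>" "u (hstep ?p ((\<delta> - s) *\<^sub>R b)) \<le> max M1 M2"
      using 1(2)[OF perp nw(1), of "t + 2 * ((2 * 1 * \<delta> - s) * symp w' b)"] T[of 1] e30 E[of 1] by auto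
    have "hstep ?p (- ((\<delta> + s) *\<^sub>R b)) = hstep ?p ((-1 * \<delta> - s) *\<^sub>R b)"
      by (simp add: algebra_simps)
    then have Q: "hstep ?p (- ((\<delta> + s) *\<^sub>R b)) \<in> \<Omega>" "u (hstep ?p (- ((\<delta> + s) *\<^sub>R b))) \<le> max M1 M2"
      using 2(2)[OF perp nw(2), of "t + 2 * ((2 * (-1) * \<delta> - s) * symp w' b)"] T[of "-1"] e30 E[of "-1"] by auto
    show "?p \<in> \<Omega>" "u ?p \<le> max M1 M2"
      using between[OF Q(1) P(1) _ _ _ Q(2) P(2)] sd \<delta>(1) by auto
  qed
qed

lemma locally_bounded_above:
  assumes "\<xi> \<in> \<Omega>"
  obtains M where "\<forall>\<^sub>F \<zeta> in nhds \<xi>. \<zeta> \<in> \<Omega> \<and> u \<zeta> \<le> M"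
proof -
  obtain e M where e: "0 < e" and M: "\<And>w t. norm w < e \<Longrightarrow> \<bar>t\<bar> < e \<Longrightarrow>
    \<xi> \<circ>\<^sub>H (fst w, snd w, t) \<in> \<Omega> \<and> u (\<xi> \<circ>\<^sub>H (fst w, snd w, t)) \<le> M"
    using bounded_above_along[of Basis \<xi>] assms by (auto simp del: split_paired_All)
  \<comment> \<open>\<open>w\<close> and \<open>t\<close> are the left-invariant coordinates of
    \<open>\<zeta>\<close> centred at \<open>\<xi>\<close>.\<close>
  define w where "w \<zeta> = Pr1 \<zeta> - Pr1 \<xi>" for \<zeta>
  define t where "t \<zeta> = snd (snd \<zeta>) - snd (snd (hstep \<xi> (w \<zeta>)))" for \<zeta>
  have eq: "\<xi> \<circ>\<^sub>H (fst (w \<zeta>), snd (w \<zeta>), t \<zeta>) = \<zeta>" for \<zeta>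
    by (cases \<zeta>, cases \<xi>) (simp add: heis_unfold w_def t_def)
  have "(w \<longlongrightarrow> w \<xi>) (nhds \<xi>)"
    unfolding w_def Pr1_def split_beta by (intro tendsto_intros filterlim_ident)
  then have tw: "(w \<longlongrightarrow> 0) (nhds \<xi>)" by (simp add: w_def)
  have "(t \<longlongrightarrow> snd (snd \<xi>) - snd (snd (hstep \<xi> 0))) (nhds \<xi>)"
    unfolding t_def by (intro tendsto_intros tw filterlim_ident)
  then have tt: "(t \<longlongrightarrow> 0) (nhds \<xi>)" by simp
  have "\<forall>\<^sub>F \<zeta> in nhds \<xi>. norm (w \<zeta>) < e \<and> \<bar>t \<zeta>\<bar> < e"
    using tendstoD[OF tw e] tendstoD[OF tt e] by (auto simp: dist_norm elim: eventually_elim2)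
  then have "\<forall>\<^sub>F \<zeta> in nhds \<xi>. \<zeta> \<in> \<Omega> \<and> u \<zeta> \<le> M"
    by eventually_elim (use M eq in metis)
  then show thesis by (rule that)
qed

section \<open>Continuity of H-convex functions\<close>

text \<open>A local upper bound \<open>M\<close> suffices. Convexity between \<open>p x\<close> and
  the point at \<open>h x / r\<close> bounds the new value from above; convexity between the new
  point and one beyond \<open>p x\<close> on the same line bounds it from below. Only convergence of
  \<open>u\<close> along \<open>p\<close> is assumed, so the lemma can be iterated along a
  path.\<close>

lemma tendsto_u_hstep:
  assumes "\<xi> \<in> \<Omega>" "(p \<longlongrightarrow> \<xi>) F" "(h \<longlongrightarrow> 0) F" "((\<lambda>x. u (p x)) \<longlongrightarrow> u \<xi>) F"
  shows "((\<lambda>x. u (hstep (p x) (h x))) \<longlongrightarrow> u \<xi>) F"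
proof (rule tendstoI)
  fix e :: real assume e: "0 < e"
  obtain M where M: "\<forall>\<^sub>F \<zeta> in nhds \<xi>. \<zeta> \<in> \<Omega> \<and> u \<zeta> \<le> M"
    using locally_bounded_above[OF assms(1)] .
  have \<Omega>: "\<forall>\<^sub>F x in F. hstep (p x) (c *\<^sub>R h x) \<in> \<Omega> \<and> u (hstep (p x) (c *\<^sub>R h x)) \<le> M" for c
  proof -
    have "((\<lambda>x. hstep (p x) (c *\<^sub>R h x)) \<longlongrightarrow> hstep \<xi> (c *\<^sub>R 0)) F"
      by (intro tendsto_intros assms)
    then show ?thesis using eventually_compose_filterlim[OF M] by simp
  qed
  have "((\<lambda>r. (1 - r) * u \<xi> + r * M) \<longlongrightarrow> (1 - 0) * u \<xi> + 0 * M) (at_right 0)"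
    "((\<lambda>r. (u \<xi> - r * M) / (1 - r)) \<longlongrightarrow> (u \<xi> - 0 * M) / (1 - 0)) (at_right 0)"
    by (intro tendsto_intros; simp)+
  then have "\<forall>\<^sub>F r in at_right 0. (1 - r) * u \<xi> + r * M < u \<xi> + e" 
    "\<forall>\<^sub>F r in at_right 0. u \<xi> - e < (u \<xi> - r * M) / (1 - r)"
    using e by (auto elim!: order_tendstoD)
  \<comment> \<open>\<open>r\<close> is fixed before \<open>x\<close> moves: small enough for both
    bounds at \<open>\<xi>\<close> to be within \<open>e\<close>, while \<open>h x / r\<close> still
    tends to 0.\<close>
  then have "\<forall>\<^sub>F r::real in at_right 0. 0 < r \<and> r < 1 \<and> (1 - r) * u \<xi> + r * M < u \<xi> + e \<and> u \<xi> - e < (u \<xi> - r * M) / (1 - r)"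
    by (intro eventually_conj eventually_at_right_less)
       (auto intro: eventually_at_rightI[of 0 1])
  then obtain r :: real where r: "0 < r" "r < 1" "(1 - r) * u \<xi> + r * M < u \<xi> + e" "u \<xi> - e < (u \<xi> - r * M) / (1 - r)"
    using eventually_happens'[OF trivial_limit_at_right_real] by blast
  have "((\<lambda>x. (1 - r) * u (p x) + r * M) \<longlongrightarrow> (1 - r) * u \<xi> + r * M) F"
    "((\<lambda>x. (u (p x) - r * M) / (1 - r)) \<longlongrightarrow> (u \<xi> - r * M) / (1 - r)) F"
    using r by (intro tendsto_intros assms; simp)+
  then have 1: "\<forall>\<^sub>F x in F. (1 - r) * u (p x) + r * M < u \<xi> + e"
    and 2: "\<forall>\<^sub>F x in F. u \<xi> - e < (u (p x) - r * M) / (1 - r)"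
    using r order_tendstoD by blast+
  show "\<forall>\<^sub>F x in F. dist (u (hstep (p x) (h x))) (u \<xi>) < e"
    using 1 2 \<Omega>[of 0] \<Omega>[of 1] \<Omega>[of "1 / r"] \<Omega>[of "- ((1 - r) / r)"]
  proof eventually_elim
    case (elim x)
    let ?q = "hstep (p x) (h x)"
    have "u ?q \<le> (1 - r) * u (p x) + r * u (hstep (p x) ((1 / r) *\<^sub>R h x))"
      using hstep_le[of "p x" "(1 / r) *\<^sub>R h x" r] elim r by simp
    also have "\<dots> \<le> (1 - r) * u (p x) + r * M" using elim r by simp
    finally have up: "u ?q < u \<xi> + e" using elim by linarith
    have e1: "hstep ?q ((- (1 / r)) *\<^sub>R h x) = hstep (p x) ((- ((1 - r) / r)) *\<^sub>R h x)"
    proof -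
      have "1 + - (1 / r) = - ((1 - r) / r)" using r by (simp add: divide_simps)
      then show ?thesis using hstep_hstep[of "p x" 1 "h x" "- (1 / r)"] by simp
    qed
    have "u (p x) \<le> (1 - r) * u ?q + r * u (hstep ?q ((- (1 / r)) *\<^sub>R h x))"
      using hstep_le[of ?q "(- (1 / r)) *\<^sub>R h x" r] elim(4,6) r unfolding e1 by simp
    also have "\<dots> \<le> (1 - r) * u ?q + r * M" using elim(6) r unfolding e1 by simp
    finally have "(u (p x) - r * M) / (1 - r) \<le> u ?q" using r by (simp add: divide_simps mult.commute)
    then show ?case using up elim(2) by (simp add: dist_real_def abs_less_iff)
  qed
qed

text \<open>The rectangle path below has vertical displacement \<open>- 4 * a * b\<close>; the choice of \<open>a\<close> and \<open>b\<close>
  relies on \<open>sqrt\<close> being odd.\<close>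

lemma continuous: "continuous_on \<Omega> u"
  unfolding continuous_on_eq_continuous_at[OF op]
proof (intro ballI)
  fix \<xi> assume \<xi>: "\<xi> \<in> \<Omega>"
  let ?F = "nhds \<xi>"
  obtain i :: 'n where True by simp
  define e :: "real^'n" where "e = axis i 1"
  have ee: "e \<bullet> e = 1" by (simp add: e_def inner_axis_axis)
  define w where "w \<zeta> = Pr1 \<zeta> - Pr1 \<xi>" for \<zeta>
  define t where "t \<zeta> = snd (snd \<zeta>) - snd (snd (hstep \<xi> (w \<zeta>)))" for \<zeta>
  define a where "a \<zeta> = sqrt \<bar>t \<zeta>\<bar> / 2" for \<zeta>
  define b where "b \<zeta> = - sqrt (t \<zeta>) / 2" for \<zeta>
  have "(w \<longlongrightarrow> w \<xi>) ?F"
    unfolding w_def Pr1_def split_beta by (intro tendsto_intros filterlim_ident)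
  then have tw: "(w \<longlongrightarrow> 0) ?F" by (simp add: w_def)
  have "(t \<longlongrightarrow> snd (snd \<xi>) - snd (snd (hstep \<xi> 0))) ?F"
    unfolding t_def by (intro tendsto_intros tw filterlim_ident)
  then have tt: "(t \<longlongrightarrow> 0) ?F" by simp
  have "(a \<longlongrightarrow> sqrt \<bar>0\<bar> / 2) ?F" "(b \<longlongrightarrow> - sqrt 0 / 2) ?F"
    unfolding a_def b_def by (intro tendsto_intros tt; simp)+
  then have ta: "(a \<longlongrightarrow> 0) ?F" and tb: "(b \<longlongrightarrow> 0) ?F" by auto
  have "((\<lambda>\<zeta>. (a \<zeta> *\<^sub>R e, 0::real^'n)) \<longlongrightarrow> (0 *\<^sub>R e, 0)) ?F"
    "((\<lambda>\<zeta>. (0::real^'n, b \<zeta> *\<^sub>R e)) \<longlongrightarrow> (0, 0 *\<^sub>R e)) ?F"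
    "((\<lambda>\<zeta>. - (a \<zeta> *\<^sub>R e, 0::real^'n)) \<longlongrightarrow> - (0 *\<^sub>R e, 0)) ?F"
    "((\<lambda>\<zeta>. - (0::real^'n, b \<zeta> *\<^sub>R e)) \<longlongrightarrow> - (0, 0 *\<^sub>R e)) ?F"
    by (intro tendsto_intros ta tb)+
  then have h: "((\<lambda>\<zeta>. (a \<zeta> *\<^sub>R e, 0::real^'n)) \<longlongrightarrow> 0) ?F"
    "((\<lambda>\<zeta>. (0::real^'n, b \<zeta> *\<^sub>R e)) \<longlongrightarrow> 0) ?F"
    "((\<lambda>\<zeta>. - (a \<zeta> *\<^sub>R e, 0::real^'n)) \<longlongrightarrow> 0) ?F"
    "((\<lambda>\<zeta>. - (0::real^'n, b \<zeta> *\<^sub>R e)) \<longlongrightarrow> 0) ?F"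
    by (simp_all flip: zero_prod_def)
  \<comment> \<open>Points and values are carried through one vanishing step together. Five uses
    follow: \<open>w\<close> reaches the projection of \<open>\<zeta>\<close>, and a rectangle then
    corrects the height.\<close>
  have step: "((\<lambda>\<zeta>. hstep (p \<zeta>) (k \<zeta>)) \<longlongrightarrow> \<xi>) ?F \<and> ((\<lambda>\<zeta>. u (hstep (p \<zeta>) (k \<zeta>))) \<longlongrightarrow> u \<xi>) ?F"
    if "(p \<longlongrightarrow> \<xi>) ?F \<and> ((\<lambda>\<zeta>. u (p \<zeta>)) \<longlongrightarrow> u \<xi>) ?F" "(k \<longlongrightarrow> 0) ?F" for p k
    using that tendsto_u_hstep[OF \<xi>, of p ?F k] tendsto_hstep[of p \<xi> ?F k 0] by simp
  have "((\<lambda>_. \<xi>) \<longlongrightarrow> \<xi>) ?F \<and> ((\<lambda>_. u \<xi>) \<longlongrightarrow> u \<xi>) ?F" by simp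
  from step[OF step[OF step[OF step[OF step[OF this tw] h(1)] h(2)] h(3)] h(4)]
  have lim: "((\<lambda>\<zeta>. u (hstep (hstep (hstep (hstep (hstep \<xi> (w \<zeta>)) (a \<zeta> *\<^sub>R e, 0)) (0, b \<zeta> *\<^sub>R e))
      (- (a \<zeta> *\<^sub>R e, 0))) (- (0, b \<zeta> *\<^sub>R e)))) \<longlongrightarrow> u \<xi>) ?F"
    by blast
  have ab: "- 4 * a \<zeta> * b \<zeta> = t \<zeta>" for \<zeta>
    by (cases "t \<zeta> \<ge> 0") (auto simp: a_def b_def real_sqrt_minus abs_if)
  have "hstep (hstep (hstep (hstep (hstep \<xi> (w \<zeta>)) (a \<zeta> *\<^sub>R e, 0)) (0, b \<zeta> *\<^sub>R e))
      (- (a \<zeta> *\<^sub>R e, 0))) (- (0, b \<zeta> *\<^sub>R e)) = hstep \<xi> (w \<zeta>) \<circ>\<^sub>H (0, 0, - 4 * a \<zeta> * b \<zeta>)" for \<zeta>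
    by (simp add: heis_unfold algebra_simps ee)
  also have "\<dots> \<zeta> = \<zeta>" for \<zeta>
    unfolding ab by (cases \<zeta>, cases \<xi>) (simp add: heis_unfold w_def t_def)
  finally have "(u \<longlongrightarrow> u \<xi>) ?F" using lim by simp
  then show "continuous (at \<xi>) u"
    by (simp add: continuous_at tendsto_at_iff_tendsto_nhds)
qed

section \<open>Descent directions\<close>

text \<open>Continuity keeps the full step \<open>h\<close> descending from nearby points, and
  convexity passes this on to all shorter steps. The product filter lets the base point move while
  the step length shrinks.\<close>

lemma descent_persists:
  assumes "\<xi> \<in> \<Omega>" "hstep \<xi> h \<in> \<Omega>" "u (hstep \<xi> h) < u \<xi>" "0 < c"
  shows "\<forall>\<^sub>F (\<zeta>, r) in nhds \<xi> \<times>\<^sub>F at_right 0. u (hstep \<zeta> (r *\<^sub>R (c *\<^sub>R h))) < u \<zeta>"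
proof -
  have u: "(u \<longlongrightarrow> u \<zeta>) (nhds \<zeta>)" if "\<zeta> \<in> \<Omega>" for \<zeta>
    using continuous that by (simp add: continuous_on_eq_continuous_at[OF op] continuous_at tendsto_at_iff_tendsto_nhds)
  have s: "((\<lambda>\<zeta>. hstep \<zeta> h) \<longlongrightarrow> hstep \<xi> h) (nhds \<xi>)" by (intro tendsto_intros filterlim_ident)
  obtain m where m: "u (hstep \<xi> h) < m" "m < u \<xi>" using dense assms(3) by blast
  have "\<forall>\<^sub>F \<zeta> in nhds \<xi>. u (hstep \<zeta> h) < m"
    using order_tendstoD(2)[OF filterlim_compose[OF u[OF assms(2)] s] m(1)] .
  moreover have "\<forall>\<^sub>F \<zeta> in nhds \<xi>. m < u \<zeta>" using order_tendstoD(1)[OF u[OF assms(1)] m(2)] .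
  moreover have "\<forall>\<^sub>F \<zeta> in nhds \<xi>. \<zeta> \<in> \<Omega>" using op assms(1) by (rule eventually_nhds_in_open)
  moreover have "\<forall>\<^sub>F \<zeta> in nhds \<xi>. hstep \<zeta> h \<in> \<Omega>" using topological_tendstoD[OF s op assms(2)] .
  ultimately have A: "\<forall>\<^sub>F \<zeta> in nhds \<xi>. \<zeta> \<in> \<Omega> \<and> hstep \<zeta> h \<in> \<Omega> \<and> u (hstep \<zeta> h) < u \<zeta>"
    by eventually_elim auto
  have "((\<lambda>r. r * c) \<longlongrightarrow> 0 * c) (at_right 0)" by (intro tendsto_intros)
  then have "\<forall>\<^sub>F r in at_right 0. r * c < 1" by (auto dest: order_tendstoD(2)[where a=1])
  moreover have "\<forall>\<^sub>F r::real in at_right 0. 0 < r" by (rule eventually_at_right_less)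
  ultimately have B: "\<forall>\<^sub>F r in at_right 0. 0 < r * c \<and> r * c < 1"
    by eventually_elim (use assms(4) in auto)
  show ?thesis
    using eventually_prodI[OF A B]
  proof eventually_elim
    case (elim p)
    obtain \<zeta> r where p: "p = (\<zeta>, r)" by (cases p)
    have "u (hstep \<zeta> ((r * c) *\<^sub>R h)) \<le> (1 - r * c) * u \<zeta> + (r * c) * u (hstep \<zeta> h)"
      using elim by (intro hstep_le) (auto simp: p)
    also have "\<dots> < (1 - r * c) * u \<zeta> + (r * c) * u \<zeta>" using elim by (simp add: p mult_strict_left_mono)
    finally show ?case by (simp add: p algebra_simps)
  qed
qed

text \<open>All intermediate points tend to \<open>\<xi>\<close> as \<open>r\<close> tends to 0, so
  the assumption at \<open>\<xi>\<close> applies to each step from wherever the walk has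
  arrived.\<close>

lemma walk_descends:
  assumes "\<And>h. h \<in> set hs \<Longrightarrow> \<forall>\<^sub>F (\<zeta>, r) in nhds \<xi> \<times>\<^sub>F at_right 0. u (hstep \<zeta> (r *\<^sub>R h)) < u \<zeta>"
  shows "\<forall>\<^sub>F r in at_right 0. hs \<noteq> [] \<longrightarrow> u (foldl hstep \<xi> (map ((*\<^sub>R) r) hs)) < u \<xi>"
  using assms
proof (induction hs rule: rev_induct)
  case (snoc h hs)
  have "((\<lambda>r. foldl hstep \<xi> (map ((*\<^sub>R) r) hs)) \<longlongrightarrow> \<xi>) (at_right 0)"
  proof (induction hs rule: rev_induct)
    case (snoc h hs)
    have "((\<lambda>r. hstep (foldl hstep \<xi> (map ((*\<^sub>R) r) hs)) (r *\<^sub>R h)) \<longlongrightarrow> hstep \<xi> (0 *\<^sub>R h)) (at_right 0)"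
      by (intro tendsto_intros snoc)
    then show ?case by simp
  qed simp
  then have "filterlim (\<lambda>r. (foldl hstep \<xi> (map ((*\<^sub>R) r) hs), r)) (nhds \<xi> \<times>\<^sub>F at_right 0) (at_right 0)"
    by (intro filterlim_Pair filterlim_ident)
  then have "\<forall>\<^sub>F r in at_right 0. u (hstep (foldl hstep \<xi> (map ((*\<^sub>R) r) hs)) (r *\<^sub>R h)) < u (foldl hstep \<xi> (map ((*\<^sub>R) r) hs))"
    using eventually_compose_filterlim[OF snoc.prems[of h]] by force
  moreover have "\<forall>\<^sub>F r in at_right 0. hs \<noteq> [] \<longrightarrow> u (foldl hstep \<xi> (map ((*\<^sub>R) r) hs)) < u \<xi>"
    using snoc by simp
  ultimately show ?case
    by eventually_elim (cases "hs = []"; force)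
qed simp

lemma descent_directions_positive_combination:
  assumes "finite I" "I \<noteq> {}" "\<xi> \<in> \<Omega>"
    and "\<And>i. i \<in> I \<Longrightarrow> 0 < c i" "\<And>i. i \<in> I \<Longrightarrow> hstep \<xi> (k i) \<in> \<Omega>"
    and "\<And>i. i \<in> I \<Longrightarrow> u (hstep \<xi> (k i)) < u \<xi>"
  shows "(\<Sum>i\<in>I. c i *\<^sub>R k i) \<noteq> 0"
proof
  assume 0: "(\<Sum>i\<in>I. c i *\<^sub>R k i) = 0"
  obtain xs where xs: "set xs = I" "distinct xs" using assms(1) finite_distinct_list by blast
  define hs where "hs = map (\<lambda>i. c i *\<^sub>R k i) xs"
  have "\<forall>\<^sub>F r in at_right 0. hs @ rev hs \<noteq> [] \<longrightarrow> u (foldl hstep \<xi> (map ((*\<^sub>R) r) (hs @ rev hs))) < u \<xi>"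
    using descent_persists[OF assms(3,5,6,4)] xs(1) by (intro walk_descends) (auto simp: hs_def)
  then obtain r :: real where r: "hs @ rev hs \<noteq> [] \<longrightarrow> u (foldl hstep \<xi> (map ((*\<^sub>R) r) (hs @ rev hs))) < u \<xi>"
    using eventually_happens'[OF trivial_limit_at_right_real] by blast
  have "sum_list (map ((*\<^sub>R) r) hs) = r *\<^sub>R sum_list hs"
    by (induction hs) (auto simp: algebra_simps)
  also have "sum_list hs = 0"
    using 0 xs by (simp add: hs_def sum_list_distinct_conv_sum_set)
  finally have "foldl hstep \<xi> (map ((*\<^sub>R) r) (hs @ rev hs)) = \<xi>"
    using foldl_hstep_palindrome[of \<xi> "map ((*\<^sub>R) r) hs"] by (simp add: rev_map)
  moreover have "hs \<noteq> []" using xs assms(2) by (auto simp: hs_def)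
  ultimately show False using r by simp
qed

section \<open>A minimum on some horizontal plane, by Brouwer's theorem\<close>

lemma minimum_on_some_hplane:
  fixes \<xi> :: "'n heis"
  defines "P \<equiv> hstep \<xi>"
  assumes U: "open U" "bounded U" "0 \<in> U" and P: "P ` closure U \<subseteq> \<Omega>"
    and fr: "\<And>h. h \<in> frontier U \<Longrightarrow> u \<xi> < u (P h)"
  obtains h where "h \<in> U" "\<And>\<zeta>. \<zeta> \<in> \<Omega> \<inter> hplane (P h) \<Longrightarrow> u (P h) \<le> u \<zeta>"
proof (rule ccontr)
  note min = that
  assume no_min: "\<not> thesis"
  have "\<exists>k. hstep (P h) k \<in> \<Omega> \<and> u (hstep (P h) k) < u (P h)" if "h \<in> U" for h
  proof -
    obtain \<zeta> where \<zeta>: "\<zeta> \<in> \<Omega>" "\<zeta> \<in> hplane (P h)" "u \<zeta> < u (P h)"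
      using min[OF \<open>h \<in> U\<close>] no_min by force
    show ?thesis
      using \<zeta>(1,3) by (intro exI[of _ "Pr1 \<zeta> - Pr1 (P h)"]) (simp flip: hplane_eq_hstep[OF \<zeta>(2)])
  qed
  then obtain k where k: "\<And>h. h \<in> U \<Longrightarrow> hstep (P h) (k h) \<in> \<Omega> \<and> u (hstep (P h) (k h)) < u (P h)"
    by metis
  have P0: "P 0 = \<xi>" by (simp add: P_def)
  have U\<Omega>: "P h \<in> \<Omega>" if "h \<in> U" for h using P closure_subset that by blast
  have \<xi>: "\<xi> \<in> \<Omega>" using U\<Omega>[OF U(3)] P0 by simp
  \<comment> \<open>The direction chosen at \<open>g\<close> still descends on \<open>N g\<close>;
    \<open>W\<close> takes care of the rest of the ball. Points outside \<open>closure U\<close> lie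
    in \<open>W\<close> vacuously, which makes \<open>W\<close> open.\<close>
  define N where "N g = {h \<in> U. hstep (P h) (k g) \<in> \<Omega> \<and> u (hstep (P h) (k g)) < u (P h)}" for g
  define W where "W = {h. h \<in> closure U \<longrightarrow> u \<xi> < u (P h)}"
  have contu: "continuous_on S (\<lambda>h. u (f h))" if "continuous_on S f" "f ` S \<subseteq> \<Omega>" for f and S :: "((real^'n) \<times> (real^'n)) set"
    using continuous_on_compose2[OF continuous that] .
  have opN: "open (N g)" for g
  proof -
    let ?S = "U \<inter> (\<lambda>h. hstep (P h) (k g)) -` \<Omega>"
    have S: "open ?S" unfolding P_def by (intro open_Int U(1) open_vimage op continuous_intros)
    have "open (?S \<inter> (\<lambda>h. u (P h) - u (hstep (P h) (k g))) -` {0<..})"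
      using U\<Omega> by (intro continuous_open_preimage S open_greaterThan continuous_on_diff contu)
        (auto simp: P_def intro!: continuous_intros)
    also have "?S \<inter> (\<lambda>h. u (P h) - u (hstep (P h) (k g))) -` {0<..} = N g" by (auto simp: N_def)
    finally show ?thesis .
  qed
  have opW: "open W"
  proof -
    have "closed (closure U \<inter> (\<lambda>h. u (P h)) -` {..u \<xi>})"
      using P by (intro continuous_closed_preimage contu) (auto simp: P_def intro!: continuous_intros)
    also have "closure U \<inter> (\<lambda>h. u (P h)) -` {..u \<xi>} = - W" by (auto simp: W_def)
    finally show ?thesis by (simp add: closed_def)
  qed
  obtain R where R: "0 < R" "closure U \<subseteq> ball 0 R"
    using bounded_subset_ballD[of "closure U" 0] U(2) by auto
  have "cball 0 R \<subseteq> W \<union> (\<Union>g\<in>U. N g)"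
  proof
    fix h :: "(real^'n) \<times> (real^'n)"
    show "h \<in> W \<union> (\<Union>g\<in>U. N g)"
    proof (cases "h \<in> U")
      case True
      then have "h \<in> N h" using k by (auto simp: N_def)
      then show ?thesis using True by blast
    next
      case False
      then have "h \<in> W" using fr U(1) by (auto simp: W_def frontier_def interior_open)
      then show ?thesis by blast
    qed
  qed
  then have "cball 0 R - W \<subseteq> (\<Union>g\<in>U. N g)" by blast
  moreover have "compact (cball 0 R - W)" using opW by (intro compact_diff) auto
  ultimately obtain I where "I \<subseteq> U" "finite I" "cball 0 R - W \<subseteq> (\<Union>g\<in>I. N g)"
    using opN by (elim compactE_image) auto
  then have I: "finite I" "I \<subseteq> U" "cball 0 R \<subseteq> W \<union> (\<Union>g\<in>I. N g)" by auto
  have W0: "0 \<notin> W" using U(3) closure_subset P0 by (auto simp: W_def)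
  have NR: "N g \<noteq> UNIV" for g
    using U(2) bounded_subset[of U "N g"] by (auto simp: N_def)
  \<comment> \<open>The distance to the complement is a continuous weight that is positive exactly
    on an open \<open>S\<close>. The case \<open>S = UNIV\<close> must be excluded, since
    \<open>infdist\<close> to the empty set is 0.\<close>
  define \<phi> where "\<phi> S h = infdist h (- S)" for S and h :: "(real^'n) \<times> (real^'n)"
  have \<phi>_pos: "0 < \<phi> S h \<longleftrightarrow> h \<in> S" if "open S" "S \<noteq> UNIV" for S h
    using in_closed_iff_infdist_zero[of "- S" h] infdist_nonneg[of h "- S"] that
    by (auto simp: \<phi>_def order_less_le)
  have \<phi>_0: "\<phi> S h = 0" if "h \<notin> S" for S h using that by (simp add: \<phi>_def)
  \<comment> \<open>Moving by \<open>- h\<close> from \<open>P h\<close> leads to \<open>\<xi>\<close>, which is a descent on \<open>U \<inter> W\<close>.\<close>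
  define G where "G h = \<phi> W h *\<^sub>R (- h) + (\<Sum>g\<in>I. \<phi> (N g) h *\<^sub>R k g)" for h
  have G_outside: "G h = - \<phi> W h *\<^sub>R h" if "h \<notin> U" for h
    using that \<phi>_0 by (simp add: G_def N_def)
  have G_nz: "G h \<noteq> 0" if h: "h \<in> cball 0 R" for h
  proof (cases "h \<in> U")
    case False
    then have "h \<in> W" using I(3) h by (auto simp: N_def)
    then have "\<phi> W h \<noteq> 0" using \<phi>_pos[OF opW, of h] W0 by (metis UNIV_I less_irrefl)
    moreover have "h \<noteq> 0" using False U(3) by auto
    ultimately show ?thesis using G_outside[OF False] by simp
  next
    case True
    \<comment> \<open>\<open>J\<close> indexes the terms of \<open>G h\<close> with positive weight:
      \<open>None\<close> stands for the direction \<open>- h\<close>, \<open>Some g\<close> for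
      \<open>k g\<close>.\<close>
    define J where "J = Some ` {g \<in> I. h \<in> N g} \<union> (if h \<in> W then {None} else {})"
    define c where "c = case_option (\<phi> W h) (\<lambda>g. \<phi> (N g) h)"
    define d where "d = case_option (- h) k"
    have "h \<in> W \<or> (\<exists>g\<in>I. h \<in> N g)" using I(3) h by blast
    then have J: "finite J" "J \<noteq> {}" using I(1) unfolding J_def by auto
    have Ph: "hstep (P h) (- h) = \<xi>" by (simp add: P_def)
    have "h \<in> closure U" using True closure_subset by blast
    have d: "hstep (P h) (d i) \<in> \<Omega> \<and> u (hstep (P h) (d i)) < u (P h) \<and> 0 < c i" if "i \<in> J" for i
    proof (cases i)
      case None
      then show ?thesis using that \<xi> Ph \<open>h \<in> closure U\<close> W0 \<phi>_pos[OF opW, of h]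
        by (auto simp: J_def d_def c_def W_def split: if_splits)
    next
      case (Some g)
      then have "h \<in> N g" using that by (auto simp: J_def split: if_splits)
      then show ?thesis using Some \<phi>_pos[OF opN[of g] NR[of g], of h] k
        by (simp add: d_def c_def) (simp add: N_def)
    qed
    have "(\<Sum>i\<in>J. c i *\<^sub>R d i) \<noteq> 0"
      using d by (intro descent_directions_positive_combination[OF J U\<Omega>[OF True]]) auto
    also have "(\<Sum>i\<in>J. c i *\<^sub>R d i) = (\<Sum>i\<in>insert None (Some ` I). c i *\<^sub>R d i)"
      using I(1) \<phi>_0[of h]
      by (intro sum.mono_neutral_left) (auto simp: J_def c_def inj_image_mem_iff split: if_splits)
    also have "\<dots> = G h"
      using I(1) by (simp add: G_def sum.reindex c_def d_def)
    finally show ?thesis .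
  qed
  have cG: "continuous_on (cball 0 R) G"
    unfolding G_def \<phi>_def by (intro continuous_intros)
  \<comment> \<open>\<open>T\<close> maps the ball to its boundary sphere, so a fixed point lies
    outside \<open>U\<close>. There \<open>G h\<close> is a nonpositive multiple of
    \<open>h\<close>, hence \<open>T h\<close> cannot equal \<open>h\<close>.\<close>
  define T where "T h = (R / norm (G h)) *\<^sub>R G h" for h
  have cT: "continuous_on (cball 0 R) T"
    unfolding T_def using G_nz by (intro continuous_intros cG) auto
  have nT: "norm (T h) = R" if "h \<in> cball 0 R" for h
    using G_nz[OF that] R(1) by (simp add: T_def)
  then have "T \<in> cball 0 R \<rightarrow> cball 0 R" by (intro Pi_I) simp
  then obtain h where h: "h \<in> cball 0 R" "T h = h"
    by (rule brouwer_ball[OF R(1) cT])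
  have "norm h = R" using nT[OF h(1)] h(2) by simp
  then have "h \<notin> U" using R(2) closure_subset by fastforce
  then have "h = (- (R * \<phi> W h / norm (G h))) *\<^sub>R h"
    using h(2) G_outside[of h] by (simp add: T_def)
  then have "(1 + R * \<phi> W h / norm (G h)) *\<^sub>R h = 0"
    unfolding scaleR_add_left scaleR_one eq_neg_iff_add_eq_0 scaleR_minus_left .
  moreover have "0 \<le> R * \<phi> W h / norm (G h)"
    using R(1) by (simp add: \<phi>_def infdist_nonneg)
  ultimately show False using \<open>norm h = R\<close> R(1) by auto
qed

end

section \<open>Reduction to slope zero and conclusion\<close>

text \<open>\<open>Pr1\<close> is affine along horizontal segments, so the subtracted term satisfies
  the convexity inequality with equality.\<close>

lemma Hconvex_fun_diff_linear:
  assumes "Hconvex_fun \<Omega> u"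
  shows "Hconvex_fun \<Omega> (\<lambda>\<xi>. u \<xi> - p \<bullet> Pr1 \<xi>)"
  unfolding Hconvex_fun_def
proof (intro ballI allI impI)
  fix \<xi>1 \<xi>2 r assume *: "\<xi>1 \<in> \<Omega>" "\<xi>2 \<in> \<Omega>" "\<xi>1 \<in> hplane \<xi>2 \<and> 0 \<le> r \<and> r \<le> (1::real)"
  let ?m = "\<xi>1 \<circ>\<^sub>H heis_dil r (heis_inv \<xi>1 \<circ>\<^sub>H \<xi>2)"
  have "Pr1 ?m = (1 - r) *\<^sub>R Pr1 \<xi>1 + r *\<^sub>R Pr1 \<xi>2"
    by (simp add: heis_unfold algebra_simps)
  then have "p \<bullet> Pr1 ?m = (1 - r) * (p \<bullet> Pr1 \<xi>1) + r * (p \<bullet> Pr1 \<xi>2)"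
    by (simp add: inner_add_right)
  moreover have "u ?m \<le> (1 - r) * u \<xi>1 + r * u \<xi>2"
    using assms * unfolding Hconvex_fun_def by blast
  ultimately show "u ?m - p \<bullet> Pr1 ?m \<le> (1 - r) * (u \<xi>1 - p \<bullet> Pr1 \<xi>1) + r * (u \<xi>2 - p \<bullet> Pr1 \<xi>2)"
    by (simp add: algebra_simps)
qed

theorem theorem3p2:
  fixes \<Omega>0 \<Omega> :: "'n::finite heis set"
    and u v :: "'n heis \<Rightarrow> real"
    and \<xi>0 :: "'n heis"
    and p0 :: "(real^'n) \<times> (real^'n)"
  assumes "open \<Omega>0" and "open \<Omega>"
    and "horiz_bounded \<Omega>0" and "horiz_bounded \<Omega>"
    and "Hconvex_set \<Omega>" and "closure \<Omega>0 \<subseteq> \<Omega>"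
    and "Hconvex_fun \<Omega> u" and "Hconvex_fun \<Omega> v"
    and "\<xi>0 \<in> \<Omega>0" and "u \<xi>0 \<le> v \<xi>0"
    and "\<forall>\<xi>\<in>frontier \<Omega>0 \<inter> hplane \<xi>0. u \<xi> \<ge> v \<xi>"
    and "p0 \<in> Hsubdiff \<Omega> v \<xi>0"
    and "\<forall>\<xi>\<in>frontier \<Omega>0 \<inter> hplane \<xi>0. v \<xi> > v \<xi>0 + p0 \<bullet> (Pr1 \<xi> - Pr1 \<xi>0)"
  shows "p0 \<in> Hsubdiff_set \<Omega> u (\<Omega>0 \<inter> hplane \<xi>0)"
proof -
  define w where "w \<xi> = u \<xi> - p0 \<bullet> Pr1 \<xi>" for \<xi>
  interpret hconvex \<Omega> w
    using assms(2,5) Hconvex_fun_diff_linear[OF assms(7), of p0] unfolding w_def by unfold_locales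
  define U where "U = hstep \<xi>0 -` \<Omega>0"
  have cont: "continuous_on UNIV (hstep \<xi>0)" by (intro continuous_intros)
  have opU: "open U" unfolding U_def using cont assms(1) by (simp add: open_vimage continuous_on_eq_continuous_at)
  obtain C where C: "\<And>a. a \<in> \<Omega>0 \<inter> hplane \<xi>0 \<Longrightarrow> dH a \<xi>0 \<le> C"
    using assms(3,9) hstep_mem_hplane[of \<xi>0 0] unfolding horiz_bounded_def hstep_zero by blast
  have "norm h \<le> C" if "h \<in> U" for h
    using C[of "hstep \<xi>0 h"] that hstep_mem_hplane[of \<xi>0 h] by (simp add: U_def dH_hstep)
  then have bdU: "bounded U" unfolding bounded_iff by blast
  have cl: "hstep \<xi>0 ` closure U \<subseteq> closure \<Omega>0"
    by (rule image_closure_subset[OF continuous_on_subset[OF cont]])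
       (use closure_subset in \<open>auto simp: U_def\<close>)
  have fr: "w \<xi>0 < w (hstep \<xi>0 h)" if h: "h \<in> frontier U" for h
  proof -
    \<comment> \<open>As \<open>U\<close> is open, a frontier point of \<open>U\<close> lies in its
      closure but not in \<open>U\<close>; its image is thus in \<open>closure \<Omega>0\<close> but
      not in \<open>\<Omega>0\<close>.\<close>
    have "hstep \<xi>0 h \<in> frontier \<Omega>0 \<inter> hplane \<xi>0"
      using h cl opU assms(1) hstep_mem_hplane[of \<xi>0 h] by (auto simp: frontier_def interior_open U_def)
    \<comment> \<open>With the slope \<open>p0\<close> subtracted, the chain is: \<open>u\<close> at
      \<open>\<xi>0\<close> is at most \<open>v\<close> at \<open>\<xi>0\<close>, which is less than
      \<open>v\<close> at the frontier point, which is at most \<open>u\<close> there.\<close>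
    from assms(11)[rule_format, OF this] assms(13)[rule_format, OF this]
    show ?thesis using assms(10) by (simp add: w_def inner_add_right)
  qed
  obtain h where h: "h \<in> U" "\<And>\<zeta>. \<zeta> \<in> \<Omega> \<inter> hplane (hstep \<xi>0 h) \<Longrightarrow> w (hstep \<xi>0 h) \<le> w \<zeta>"
  proof (rule minimum_on_some_hplane[of U \<xi>0])
    show "0 \<in> U" using assms(9) by (simp add: U_def)
    show "hstep \<xi>0 ` closure U \<subseteq> \<Omega>" using cl assms(6) by blast
  qed (use opU bdU fr in auto)
  \<comment> \<open>Minimality of \<open>w\<close> on the plane is the subgradient inequality for
    \<open>u\<close> with slope \<open>p0\<close>.\<close>
  have "p0 \<in> Hsubdiff \<Omega> u (hstep \<xi>0 h)"
    using h(2) unfolding Hsubdiff_def by (fastforce simp: w_def inner_diff_right simp del: Pr1_hstep)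
  then show ?thesis
    using h(1) hstep_mem_hplane unfolding Hsubdiff_set_def U_def by blast
qed

end
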